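(* Suppose that \[ B(\zeta)=\sigma\,\frac{\zeta-a}{1-\overline{a}\zeta}\,\frac{\zeta-b}{1-\overline{b}\zeta}, \] where $a,b\in\mathbb{D}\cap\mathbb{R}$ and $\sigma\in\mathbb{T}$. Then $\zeta\mapsto B(\zeta)/\zeta$ is a circle homeomorphism if and only if one of the following conditions holds: (a) $ab\ge 0$ and $1-|a|-|b|-3ab\ge 0$; (b) $ab\le 0$ and $1+ab-a^2-b^2\ge 0$.
   Context: $\mathbb{T}=\{z\in\mathbb{C}\colon |z|=1\}$ and $\mathbb{D}=\{z\in\mathbb{C}\colon |z|<1\}$. A circle homeomorphism is a homeomorphism of $\mathbb{T}$ onto itself; throughout, circle homeomorphisms are assumed sense-preserving. The function $B(\zeta)/\zeta$ is regarded as a function of $\zeta\in\mathbb{T}$. *)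

theory Defs
  imports "HOL-Analysis.Analysis"
begin

(* A homeomorphism f of the unit circle is sense-preserving if its argument increases as the
   argument of the point increases, i.e. if f has a continuous increasing lift to the real line.
   For a homeomorphism such a lift automatically satisfies phi (t + 2 * pi) = phi t + 2 * pi. *)
definition sense_preserving_on_circle :: "(complex \<Rightarrow> complex) \<Rightarrow> bool" where
  "sense_preserving_on_circle f \<longleftrightarrow>
     (\<exists>\<phi> :: real \<Rightarrow> real.
        continuous_on UNIV \<phi> \<and> strict_mono \<phi> \<and> (\<forall>t. f (cis t) = cis (\<phi> t)))"

(* Only the values of f on the unit circle matter. *)
definition circle_homeomorphism :: "(complex \<Rightarrow> complex) \<Rightarrow> bool" where
  "circle_homeomorphism f \<longleftrightarrow>
     (\<exists>g. homeomorphism (sphere 0 1) (sphere 0 1) f g) \<and> sense_preserving_on_circle f"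

end

theory Submission
  imports Defs
begin

text \<open>On the circle, the Blaschke factor \<open>(\<zeta> - a) / (1 - a \<zeta>)\<close> equals \<open>\<zeta> * cnj w / w\<close> with
  \<open>w = 1 - a \<zeta>\<close> in the right half-plane, so \<open>B \<zeta> / \<zeta>\<close> has an explicit lift to the real line. Its
  derivative is a sum of two Poisson kernels minus one, which has the sign of a quadratic polynomial
  in \<open>cos t\<close>. The lift of a sense-preserving homeomorphism is unique up to a constant, so the
  question is when this quadratic is nonnegative on \<open>[-1, 1]\<close>. For \<open>a b \<ge> 0\<close> it is concave and
  the endpoints decide; for \<open>a b < 0\<close> it is convex with vertex \<open>(a + b) / 2\<close>.\<close>

section \<open>Lifts of circle maps\<close>

text \<open>An increasing lift that gains exactly \<open>2 * pi\<close> per period maps a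
  fundamental interval bijectively onto one of the same length, so \<open>f\<close> is bijective on
  the circle; compactness makes the inverse continuous.\<close>

lemma circle_homeomorphism_if_lift:
  fixes f :: "complex \<Rightarrow> complex" and \<phi> :: "real \<Rightarrow> real"
  assumes f: "continuous_on (sphere 0 1) f"
    and \<phi>: "continuous_on UNIV \<phi>" and mono: "strict_mono \<phi>"
    and period: "\<And>t. \<phi> (t + 2 * pi) = \<phi> t + 2 * pi"
    and lift: "\<And>t. f (cis t) = cis (\<phi> t)"
  shows "circle_homeomorphism f"
proof -
  have param: "\<exists>t\<in>{0..<2*pi}. z = cis t" if z: "z \<in> sphere 0 1" for z :: complex
  proof -
    obtain t where "0 \<le> t" "t < 2 * pi" "z = Complex (cos t) (sin t)"
      using complex_unimodular_polar[of z] z by auto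
    then show ?thesis
      by (auto simp: cis.code)
  qed
  have inj: "inj_on f (sphere 0 1)"
  proof (rule inj_onI)
    fix z w assume z: "z \<in> sphere 0 1" and w: "w \<in> sphere 0 1" and eq: "f z = f w"
    obtain s t where s: "s \<in> {0..<2*pi}" "z = cis s" and t: "t \<in> {0..<2*pi}" "w = cis t"
      using param z w by meson
    have "cis (\<phi> s - \<phi> t) = 1"
      using eq s t by (simp add: lift flip: cis_divide)
    then obtain n :: int where n: "\<phi> s - \<phi> t = 2 * pi * of_int n"
      by (auto simp: complex_eq_iff cos_one_2pi_int mult_ac)
    \<comment> \<open>Points of \<open>[0, 2 * pi)\<close> lie less than a period apart, so their
      lifted values differ by less than \<open>2 * pi\<close>, which leaves only
      \<open>n = 0\<close>.\<close>
    have "\<phi> s < \<phi> (t + 2 * pi)" "\<phi> t < \<phi> (s + 2 * pi)"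
      using s t by (auto intro!: strict_monoD[OF mono])
    hence "2 * pi * of_int n < 2 * pi * 1" "2 * pi * (- 1) < 2 * pi * of_int n"
      unfolding n[symmetric] by (simp_all add: period)
    hence "real_of_int n < 1" "- 1 < real_of_int n"
      using mult_less_cancel_left_pos[of "2 * pi"]
      by (simp_all only: pi_gt_zero mult_pos_pos zero_less_numeral)
    hence "n = 0"
      by linarith
    thus "z = w"
      using n s t strict_mono_eq[OF mono, of s t] by simp
  qed
  have surj: "f ` sphere 0 1 = sphere 0 1"
  proof (intro equalityI subsetI)
    fix w assume "w \<in> f ` sphere 0 1"
    then show "w \<in> sphere 0 1"
      using param by (force simp: lift)
  next
    fix w :: complex assume w: "w \<in> sphere 0 1"
    \<comment> \<open>\<open>k\<close> shifts the argument of \<open>w\<close> by full turns into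
      \<open>[\<phi> 0, \<phi> 0 + 2 * pi]\<close>, where the intermediate value theorem reaches
      it.\<close>
    define k where "k = \<lceil>(\<phi> 0 - Arg w) / (2 * pi)\<rceil>"
    define y where "y = Arg w + 2 * pi * of_int k"
    have "(\<phi> 0 - Arg w) / (2 * pi) \<le> of_int k" "of_int k \<le> (\<phi> 0 - Arg w) / (2 * pi) + 1"
      unfolding k_def by linarith+
    hence "\<phi> 0 \<le> y" "y \<le> \<phi> (2 * pi)"
      using period[of 0] by (simp_all add: y_def field_simps)
    then obtain t where t: "\<phi> t = y"
      using IVT'[of \<phi> 0 y "2 * pi"] continuous_on_subset[OF \<phi>]
      by (metis pi_ge_zero mult_nonneg_nonneg subset_UNIV zero_le_numeral)
    have "cis y = cis (Arg w)"
      by (simp add: y_def flip: cis_mult)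
    also have "\<dots> = w"
      using w rcis_cmod_Arg[of w] by (simp add: rcis_def)
    finally have "w = f (cis t)"
      by (simp add: lift t)
    then show "w \<in> f ` sphere 0 1" by auto
  qed
  have "\<exists>g. homeomorphism (sphere 0 1) (sphere 0 1) f g"
    using homeomorphism_compact[OF _ f surj inj] by auto
  then show ?thesis
    unfolding circle_homeomorphism_def sense_preserving_on_circle_def using \<phi> mono lift by blast
qed

text \<open>Two continuous lifts of one map differ by a continuous function with values in the
  multiples of \<open>2 * pi\<close>, hence by a constant. Monotonicity thus passes from the unknown
  lift in the definition to any explicit one.\<close>

lemma strict_mono_lift_if_sense_preserving:
  assumes f: "sense_preserving_on_circle f"
    and \<phi>: "continuous_on UNIV \<phi>" and lift: "\<And>t. f (cis t) = cis (\<phi> t)"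
  shows "strict_mono \<phi>"
proof -
  obtain \<psi> where \<psi>: "continuous_on UNIV \<psi>" "strict_mono \<psi>" "\<And>t. f (cis t) = cis (\<psi> t)"
    using f unfolding sense_preserving_on_circle_def by blast
  define d where "d t = (\<phi> t - \<psi> t) / (2 * pi)" for t
  have cont: "continuous_on UNIV d"
    unfolding d_def using \<phi> \<psi>(1) by (intro continuous_intros) auto
  have int: "d t \<in> \<int>" for t
  proof -
    have "cis (\<phi> t - \<psi> t) = 1"
      using lift \<psi>(3) by (simp flip: cis_divide)
    then obtain n :: int where "\<phi> t - \<psi> t = 2 * pi * of_int n"
      by (auto simp: complex_eq_iff cos_one_2pi_int mult_ac)
    thus ?thesis by (simp add: d_def)
  qed
  have "d constant_on UNIV"
  proof (rule continuous_discrete_range_constant[OF connected_UNIV cont])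
    fix t
    have "1 \<le> norm (d s - d t)" if "d s \<noteq> d t" for s
      using int[of s] int[of t] that Ints_nonzero_abs_ge1[of "d s - d t"] by auto
    then show "\<exists>e>0. \<forall>s. s \<in> UNIV \<and> d s \<noteq> d t \<longrightarrow> e \<le> norm (d s - d t)"
      by (intro exI[of _ 1]) auto
  qed
  then obtain c where c: "\<And>t. d t = c"
    by (auto simp: constant_on_def)
  have "\<phi> t = \<psi> t + 2 * pi * c" for t
    using c[of t] by (simp add: d_def field_simps)
  then show ?thesis
    using \<psi>(2) by (simp add: strict_mono_def)
qed

section \<open>The argument of a Blaschke factor\<close>

text \<open>For \<open>\<bar>a\<bar> < 1\<close> this is twice the principal argument of
  \<open>1 - a * cis (- t)\<close>. That number stays in the right half-plane, so
  \<open>arctan\<close> gives its argument without branch jumps.\<close>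

definition blaschke_angle :: "real \<Rightarrow> real \<Rightarrow> real" where
  "blaschke_angle a t = 2 * arctan (a * sin t / (1 - a * cos t))"

text \<open>For \<open>x = cos t\<close> these quantities are the real part and the squared modulus
  of \<open>1 - a * cis t\<close>.\<close>

lemma blaschke_denominator_pos:
  fixes a x :: real
  assumes "\<bar>a\<bar> < 1" "\<bar>x\<bar> \<le> 1"
  shows "1 - a * x > 0" and "1 + a\<^sup>2 - 2 * a * x > 0"
proof -
  have "\<bar>a * x\<bar> \<le> \<bar>a\<bar> * 1"
    unfolding abs_mult using assms by (intro mult_left_mono) auto
  then have ax: "\<bar>a * x\<bar> \<le> \<bar>a\<bar>"
    by simp
  show "1 - a * x > 0"
    using ax assms(1) by linarith
  have "0 < (1 - \<bar>a\<bar>)\<^sup>2"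
    using assms(1) by simp
  also have "\<dots> = 1 + a\<^sup>2 - 2 * \<bar>a\<bar>"
    by (simp add: power2_eq_square algebra_simps)
  finally show "1 + a\<^sup>2 - 2 * a * x > 0"
    using ax by linarith
qed

lemma blaschke_factor_cis:
  assumes "\<bar>a\<bar> < 1"
  shows "(cis t - of_real a) / (1 - of_real a * cis t) = cis (t + blaschke_angle a t)"
proof -
  define w where "w = 1 - of_real a * cis t"
  define \<theta> where "\<theta> = arctan (a * sin t / (1 - a * cos t))"
  have pos: "1 - a * cos t > 0"
    using blaschke_denominator_pos[OF assms] by simp
  \<comment> \<open>\<open>k\<close> is the real scale factor between \<open>cnj w\<close> and its
    direction \<open>cis \<theta>\<close>; it cancels in
    \<open>cis \<theta> / cnj (cis \<theta>)\<close>.\<close>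
  define k where "k = cos \<theta> / (1 - a * cos t)"
  have "cos \<theta> > 0"
    unfolding \<theta>_def cos_arctan by (simp add: add_pos_nonneg)
  then have k: "k \<noteq> 0" and cos: "cos \<theta> = k * (1 - a * cos t)"
    using pos by (auto simp: k_def)
  have "sin \<theta> = cos \<theta> * tan \<theta>"
    using \<open>cos \<theta> > 0\<close> by (simp add: tan_def)
  then have sin: "sin \<theta> = k * (a * sin t)"
    by (simp add: \<theta>_def tan_arctan k_def)
  have cis: "cis \<theta> = of_real k * cnj w"
    by (simp add: complex_eq_iff w_def cos sin)
  have w: "w \<noteq> 0"
    using pos by (auto simp: w_def complex_eq_iff)
  have "cis (2 * \<theta>) = cis \<theta> * cis \<theta>"
    by (simp add: cis_mult)
  also have "\<dots> = cis \<theta> / cnj (cis \<theta>)"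
    by (simp add: cis_cnj divide_inverse)
  also have "\<dots> = cnj w / w"
    using k by (simp add: cis)
  finally have 2: "cis (2 * \<theta>) = cnj w / w" .
  have "cis t - of_real a = cis t * cnj w"
    by (simp add: w_def algebra_simps cis_cnj cis_mult)
  then show ?thesis
    using 2 by (simp add: w_def blaschke_angle_def \<theta>_def flip: cis_mult)
qed

lemma blaschke_angle_add_2pi [simp]: "blaschke_angle a (t + 2 * pi) = blaschke_angle a t"
  by (simp add: blaschke_angle_def)

text \<open>The fraction is the Poisson kernel of \<open>a\<close> at \<open>cis t\<close>.\<close>

lemma has_real_derivative_blaschke_angle:
  assumes "\<bar>a\<bar> < 1"
  shows "(blaschke_angle a has_real_derivative (1 - a\<^sup>2) / (1 + a\<^sup>2 - 2 * a * cos t) - 1) (at t)"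
proof -
  define p where "p = 1 - a * cos t"
  define q where "q = a * sin t"
  have p: "p > 0" and den: "1 + a\<^sup>2 - 2 * a * cos t > 0"
    using blaschke_denominator_pos[OF assms] by (simp_all add: p_def)
  have sq: "p\<^sup>2 + q\<^sup>2 = 1 + a\<^sup>2 - 2 * a * cos t"
    using sin_cos_squared_add[of t] unfolding p_def q_def by algebra
  \<comment> \<open>The derivative of \<open>1 - a * cos t\<close> is \<open>q\<close> itself, so
    the quotient rule for \<open>q / p\<close> has numerator
    \<open>a * cos t * p - q * q\<close>.\<close>
  have num: "2 * (a * cos t * p - q * q) = (1 - a\<^sup>2) - (1 + a\<^sup>2 - 2 * a * cos t)"
    using sin_cos_squared_add[of t] unfolding p_def q_def by algebra
  have "((\<lambda>t. 2 * arctan (a * sin t / (1 - a * cos t))) has_real_derivative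
      2 * (inverse (1 + (q / p)\<^sup>2) * ((a * cos t * p - q * q) / (p * p)))) (at t)"
    using p unfolding p_def q_def by (auto intro!: derivative_eq_intros)
  also have "2 * (inverse (1 + (q / p)\<^sup>2) * ((a * cos t * p - q * q) / (p * p))) =
      2 * (a * cos t * p - q * q) / (p\<^sup>2 + q\<^sup>2)"
  proof -
    have "1 + (q / p)\<^sup>2 = (p\<^sup>2 + q\<^sup>2) / (p * p)"
      using p by (simp add: field_simps power2_eq_square)
    then show ?thesis using p by simp
  qed
  also have "\<dots> = (1 - a\<^sup>2) / (1 + a\<^sup>2 - 2 * a * cos t) - 1"
    unfolding num sq using den by (subst diff_divide_distrib) simp
  finally show ?thesis
    by (simp add: blaschke_angle_def[abs_def])
qed

section \<open>Monotonicity of the lift\<close>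

text \<open>Numerator of the two Poisson kernels minus one over their common denominator, with
  \<open>x\<close> standing for \<open>cos t\<close>.\<close>

definition lift_quadratic :: "real \<Rightarrow> real \<Rightarrow> real \<Rightarrow> real" where
  "lift_quadratic a b x =
     1 - a\<^sup>2 - b\<^sup>2 - 3 * a\<^sup>2 * b\<^sup>2 + 4 * a * b * (a + b) * x - 4 * a * b * x\<^sup>2"

definition lift_speed :: "real \<Rightarrow> real \<Rightarrow> real \<Rightarrow> real" where
  "lift_speed a b x =
     lift_quadratic a b x / ((1 + a\<^sup>2 - 2 * a * x) * (1 + b\<^sup>2 - 2 * b * x))"

lemma has_real_derivative_lift:
  assumes "\<bar>a\<bar> < 1" "\<bar>b\<bar> < 1"
  shows "((\<lambda>t. c + t + blaschke_angle a t + blaschke_angle b t)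
          has_real_derivative lift_speed a b (cos t)) (at t)"
proof -
  have a: "1 + a\<^sup>2 - 2 * a * cos t > 0" and b: "1 + b\<^sup>2 - 2 * b * cos t > 0"
    using blaschke_denominator_pos assms by simp_all
  have "((\<lambda>t. c + t + blaschke_angle a t + blaschke_angle b t) has_real_derivative
      0 + 1 + ((1 - a\<^sup>2) / (1 + a\<^sup>2 - 2 * a * cos t) - 1) + ((1 - b\<^sup>2) / (1 + b\<^sup>2 - 2 * b * cos t) - 1)) (at t)"
    using assms by (intro DERIV_add DERIV_const DERIV_ident has_real_derivative_blaschke_angle)
  also have "0 + 1 + ((1 - a\<^sup>2) / (1 + a\<^sup>2 - 2 * a * cos t) - 1) + ((1 - b\<^sup>2) / (1 + b\<^sup>2 - 2 * b * cos t) - 1)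
      = ((1 - a\<^sup>2) * (1 + b\<^sup>2 - 2 * b * cos t) + (1 - b\<^sup>2) * (1 + a\<^sup>2 - 2 * a * cos t)
          - (1 + a\<^sup>2 - 2 * a * cos t) * (1 + b\<^sup>2 - 2 * b * cos t))
        / ((1 + a\<^sup>2 - 2 * a * cos t) * (1 + b\<^sup>2 - 2 * b * cos t))"
    using a b by (simp add: add_divide_distrib diff_divide_distrib)
  also have "\<dots> = lift_speed a b (cos t)"
    unfolding lift_speed_def lift_quadratic_def
    by (rule arg_cong2[where f = "(/)"]) (simp_all add: power2_eq_square algebra_simps)
  finally show ?thesis .
qed

lemma lift_speed_nonneg_iff:
  assumes "\<bar>a\<bar> < 1" "\<bar>b\<bar> < 1" "\<bar>x\<bar> \<le> 1"
  shows "lift_speed a b x \<ge> 0 \<longleftrightarrow> lift_quadratic a b x \<ge> 0"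
proof -
  have "(1 + a\<^sup>2 - 2 * a * x) * (1 + b\<^sup>2 - 2 * b * x) > 0"
    using assms by (intro mult_pos_pos blaschke_denominator_pos)
  then show ?thesis
    unfolding lift_speed_def by (metis divide_nonneg_pos divide_neg_pos not_le)
qed

text \<open>A nonnegative derivative alone gives only weak monotonicity; finiteness of the zeros in
  \<open>x\<close> rules out intervals of constancy.\<close>

lemma finite_zeros_lift_speed:
  assumes "\<bar>a\<bar> < 1" "\<bar>b\<bar> < 1"
  shows "finite {x. \<bar>x\<bar> \<le> 1 \<and> lift_speed a b x = 0}"
proof -
  define p where
    "p = [:1 - a\<^sup>2 - b\<^sup>2 - 3 * a\<^sup>2 * b\<^sup>2, 4 * a * b * (a + b), - (4 * a * b):]"
  \<comment> \<open>If the leading coefficient vanishes, then \<open>a = 0\<close> or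
    \<open>b = 0\<close>, and the constant term is \<open>1 - b\<^sup>2\<close> or
    \<open>1 - a\<^sup>2\<close>, which is positive.\<close>
  have "p \<noteq> 0"
    using assms by (auto simp: p_def abs_square_eq_1)
  then have "finite {x. poly p x = 0}"
    by (rule poly_roots_finite)
  moreover have "poly p x = lift_quadratic a b x" for x
    by (simp add: p_def lift_quadratic_def power2_eq_square algebra_simps)
  moreover have "lift_quadratic a b x = 0" if "\<bar>x\<bar> \<le> 1" "lift_speed a b x = 0" for x
    using that blaschke_denominator_pos(2)[of a x] blaschke_denominator_pos(2)[of b x] assms
    by (auto simp: lift_speed_def)
  ultimately show ?thesis
    by (auto elim!: rev_finite_subset)
qed

text \<open>A finite connected image would be a single point. Then \<open>cos\<close> is constant on
  the interval, so \<open>sin\<close> vanishes there, and differentiating again so does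
  \<open>cos\<close>, against \<open>sin\<^sup>2 + cos\<^sup>2 = 1\<close>.\<close>

lemma infinite_cos_image:
  assumes "s < t"
  shows "infinite (cos ` {s<..<t::real})"
proof
  assume "finite (cos ` {s<..<t})"
  moreover have "connected (cos ` {s<..<t})"
    by (intro connected_continuous_image continuous_intros) simp
  ultimately obtain c where "cos ` {s<..<t} = {c}"
    using connected_finite_iff_sing[of "cos ` {s<..<t}"] assms by auto
  then have c: "cos u = c" if "u \<in> {s<..<t}" for u
    using that by blast
  have der: "g u = 0"
    if "\<And>u. (f has_real_derivative g u) (at u)" "\<And>u. u \<in> {s<..<t} \<Longrightarrow> f u = k" "u \<in> {s<..<t}"
    for f g :: "real \<Rightarrow> real" and k u
  proof -
    have "(f has_real_derivative 0) (at u)"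
      by (rule has_field_derivative_transform_within_open[OF DERIV_const[of k], of "{s<..<t}"])
        (use that in auto)
    then show ?thesis using that(1) DERIV_unique by blast
  qed
  have sin: "- sin u = 0" if "u \<in> {s<..<t}" for u
    by (rule der[of cos _ c]) (use that c in \<open>auto intro!: derivative_eq_intros\<close>)
  define m where "m = (s + t) / 2"
  have m: "m \<in> {s<..<t}"
    using assms by (simp add: m_def)
  have "cos m = 0"
    by (rule der[of sin _ 0]) (use m sin in \<open>auto intro!: derivative_eq_intros\<close>)
  then show False
    using sin[OF m] sin_cos_squared_add[of m] by simp
qed

text \<open>Every open interval contains a point \<open>u\<close> where the derivative is positive.
  The strict increase just to the right of \<open>u\<close> combines with weak monotonicity on the
  rest.\<close>

lemma strict_mono_if_deriv_cos_nonneg: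
  fixes \<phi> h :: "real \<Rightarrow> real"
  assumes deriv: "\<And>t. (\<phi> has_real_derivative h (cos t)) (at t)"
    and nonneg: "\<And>x. \<bar>x\<bar> \<le> 1 \<Longrightarrow> h x \<ge> 0"
    and finite: "finite {x. \<bar>x\<bar> \<le> 1 \<and> h x = 0}"
  shows "strict_mono \<phi>"
proof (rule strict_monoI)
  fix s t :: real assume "s < t"
  have le: "\<phi> u \<le> \<phi> v" if "u \<le> v" for u v
    using that
  proof (rule DERIV_nonneg_imp_nondecreasing)
    show "\<exists>y. (\<phi> has_real_derivative y) (at x) \<and> 0 \<le> y" for x
      using deriv[of x] nonneg[of "cos x"] by auto
  qed
  have "\<not> cos ` {s<..<t} \<subseteq> {x. \<bar>x\<bar> \<le> 1 \<and> h x = 0}"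
    using infinite_cos_image[OF \<open>s < t\<close>] finite finite_subset by blast
  then have "\<exists>u\<in>{s<..<t}. h (cos u) \<noteq> 0"
    by auto
  then obtain u where "s < u" "u < t" "h (cos u) \<noteq> 0"
    unfolding Bex_def greaterThanLessThan_iff by blast
  moreover have "h (cos u) \<ge> 0"
    using nonneg by simp
  ultimately have u: "s < u" "u < t" "h (cos u) > 0"
    by simp_all
  obtain d where d: "d > 0" "\<And>e. 0 < e \<Longrightarrow> e < d \<Longrightarrow> \<phi> u < \<phi> (u + e)"
    using DERIV_pos_inc_right[OF deriv u(3)] by blast
  define e where "e = min (d / 2) (t - u)"
  have "0 < e" "e < d" "u + e \<le> t"
    using d(1) u(2) by (auto simp: e_def)
  then show "\<phi> s < \<phi> t"
    using le[of s u] le[of "u + e" t] d(2)[of e] u by linarith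
qed

lemma strict_mono_lift_iff:
  assumes "\<bar>a\<bar> < 1" "\<bar>b\<bar> < 1"
  shows "strict_mono (\<lambda>t. c + t + blaschke_angle a t + blaschke_angle b t) \<longleftrightarrow>
    (\<forall>x\<in>{-1..1}. lift_quadratic a b x \<ge> 0)"
proof
  assume mono: "strict_mono (\<lambda>t. c + t + blaschke_angle a t + blaschke_angle b t)"
  show "\<forall>x\<in>{-1..1}. lift_quadratic a b x \<ge> 0"
  proof
    fix x :: real assume x: "x \<in> {-1..1}"
    \<comment> \<open>The derivative of the lift is evaluated at \<open>arccos x\<close>, whose
      cosine is \<open>x\<close>.\<close>
    then have "lift_speed a b (cos (arccos x)) \<ge> 0"
      using mono_on_imp_deriv_nonneg[OF _ has_real_derivative_lift[OF assms], of UNIV c]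
        strict_mono_mono[OF mono] by (simp del: cos_arccos)
    then show "lift_quadratic a b x \<ge> 0"
      using x assms lift_speed_nonneg_iff[of a b x] by (auto simp: abs_le_iff cos_arccos)
  qed
next
  assume "\<forall>x\<in>{-1..1}. lift_quadratic a b x \<ge> 0"
  then show "strict_mono (\<lambda>t. c + t + blaschke_angle a t + blaschke_angle b t)"
    using assms
    by (intro strict_mono_if_deriv_cos_nonneg[where h = "lift_speed a b"]
        has_real_derivative_lift finite_zeros_lift_speed)
      (auto simp: lift_speed_nonneg_iff abs_le_iff)
qed

section \<open>Nonnegativity of the quadratic\<close>

lemma lift_quadratic_nonneg_iff:
  assumes "\<bar>a\<bar> < 1" "\<bar>b\<bar> < 1"
  shows "(\<forall>x\<in>{-1..1}. lift_quadratic a b x \<ge> 0) \<longleftrightarrow>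
    (a * b \<ge> 0 \<and> 1 - \<bar>a\<bar> - \<bar>b\<bar> - 3 * a * b \<ge> 0) \<or>
    (a * b \<le> 0 \<and> 1 + a * b - a\<^sup>2 - b\<^sup>2 \<ge> 0)"
    (is "?nonneg \<longleftrightarrow> ?A \<or> ?B")
proof -
  have right: "lift_quadratic a b 1 = ((1 - a) * (1 - b)) * (1 + a + b - 3 * a * b)"
    and left: "lift_quadratic a b (-1) = ((1 + a) * (1 + b)) * (1 - a - b - 3 * a * b)"
    by (simp_all add: lift_quadratic_def power2_eq_square algebra_simps)
  \<comment> \<open>Completed square: for \<open>a * b \<le> 0\<close> the minimum is attained at
    \<open>(a + b) / 2\<close>, which lies in \<open>[-1, 1]\<close>, and its sign is that of
    \<open>1 + a * b - a\<^sup>2 - b\<^sup>2\<close>.\<close>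
  have vertex: "lift_quadratic a b x =
      (1 - a * b) * (1 + a * b - a\<^sup>2 - b\<^sup>2) - 4 * (a * b) * (x - (a + b) / 2)\<^sup>2" for x
    by (simp add: lift_quadratic_def power2_eq_square field_simps)
  \<comment> \<open>Twice the linear interpolation of the endpoint values plus a correction, which
    is nonnegative on \<open>[-1, 1]\<close> when \<open>a * b \<ge> 0\<close>.\<close>
  have chord: "2 * lift_quadratic a b x =
      (1 + x) * lift_quadratic a b 1 + (1 - x) * lift_quadratic a b (-1)
      + 8 * (a * b) * ((1 - x) * (1 + x))" for x
    by (simp add: lift_quadratic_def power2_eq_square algebra_simps)
  have ends: "lift_quadratic a b 1 \<ge> 0 \<and> lift_quadratic a b (-1) \<ge> 0 \<longleftrightarrow>
      1 - \<bar>a + b\<bar> - 3 * a * b \<ge> 0"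
  proof -
    have "(1 - a) * (1 - b) > 0" "(1 + a) * (1 + b) > 0"
      using assms by (auto intro!: mult_pos_pos)
    then have "lift_quadratic a b 1 \<ge> 0 \<longleftrightarrow> 1 + a + b - 3 * a * b \<ge> 0"
      "lift_quadratic a b (-1) \<ge> 0 \<longleftrightarrow> 1 - a - b - 3 * a * b \<ge> 0"
      unfolding left right by (meson mult_nonneg_nonneg mult_pos_neg not_le less_imp_le)+
    then show ?thesis by linarith
  qed
  have concave: "?nonneg \<longleftrightarrow> ?A" if ab: "a * b \<ge> 0"
  proof -
    \<comment> \<open>With no opposite signs, the joint endpoint condition \<open>ends\<close>
      becomes the first alternative.\<close>
    have "\<bar>a + b\<bar> = \<bar>a\<bar> + \<bar>b\<bar>"
      using ab by (auto simp: zero_le_mult_iff)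
    moreover have "?nonneg" if "lift_quadratic a b 1 \<ge> 0" "lift_quadratic a b (-1) \<ge> 0"
    proof
      fix x :: real assume "x \<in> {-1..1}"
      then have "1 + x \<ge> 0" "1 - x \<ge> 0" by auto
      then have "(1 + x) * lift_quadratic a b 1 \<ge> 0" "(1 - x) * lift_quadratic a b (-1) \<ge> 0"
        and "(a * b) * ((1 - x) * (1 + x)) \<ge> 0"
        using ab that mult_nonneg_nonneg by blast+
      then show "0 \<le> lift_quadratic a b x"
        using chord[of x] by linarith
    qed
    ultimately show ?thesis
      using ends ab by auto
  qed
  have convex: "?nonneg \<longleftrightarrow> ?B" if ab: "a * b \<le> 0"
  proof -
    have pos: "1 - a * b > 0"
      using ab by simp
    have "?nonneg \<longleftrightarrow> (1 - a * b) * (1 + a * b - a\<^sup>2 - b\<^sup>2) \<ge> 0"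
    proof
      assume ?nonneg
      moreover have "(a + b) / 2 \<in> {-1..1}"
        using assms by auto
      ultimately have "lift_quadratic a b ((a + b) / 2) \<ge> 0"
        by blast
      then show "(1 - a * b) * (1 + a * b - a\<^sup>2 - b\<^sup>2) \<ge> 0"
        unfolding vertex by simp
    next
      assume "(1 - a * b) * (1 + a * b - a\<^sup>2 - b\<^sup>2) \<ge> 0"
      moreover have "4 * (a * b) * (x - (a + b) / 2)\<^sup>2 \<le> 0" for x
        by (rule mult_nonpos_nonneg) (use ab in simp_all)
      ultimately have "lift_quadratic a b x \<ge> 0" for x
        unfolding vertex[of x] diff_ge_0_iff_ge using order_trans by blast
      then show ?nonneg by blast
    qed
    then show ?thesis
      using ab zero_le_mult_iff[of "1 - a * b"] pos by auto
  qed
  show ?thesis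
  proof (cases "a * b" "0::real" rule: linorder_cases)
    case less
    then have "a * b \<le> 0" "\<not> a * b \<ge> 0" by linarith+
    then show ?thesis using convex by blast
  next
    \<comment> \<open>Here both equivalences apply, so each alternative is equivalent to
      nonnegativity and so is their disjunction.\<close>
    case equal
    then have "a * b \<le> 0" "a * b \<ge> 0" by linarith+
    then show ?thesis using concave convex by blast
  next
    case greater
    then have "a * b \<ge> 0" "\<not> a * b \<le> 0" by linarith+
    then show ?thesis using concave by blast
  qed
qed

theorem theorem5p2:
  fixes a b :: real and \<sigma> :: complex and B :: "complex \<Rightarrow> complex"
  assumes "complex_of_real a \<in> ball 0 1" and "complex_of_real b \<in> ball 0 1"
    and "\<sigma> \<in> sphere 0 1"
    and "\<And>\<zeta>. B \<zeta> =
           \<sigma> * ((\<zeta> - complex_of_real a) / (1 - cnj (complex_of_real a) * \<zeta>))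
             * ((\<zeta> - complex_of_real b) / (1 - cnj (complex_of_real b) * \<zeta>))"
  shows "circle_homeomorphism (\<lambda>\<zeta>. B \<zeta> / \<zeta>) \<longleftrightarrow>
           (a * b \<ge> 0 \<and> 1 - \<bar>a\<bar> - \<bar>b\<bar> - 3 * a * b \<ge> 0) \<or>
           (a * b \<le> 0 \<and> 1 + a * b - a\<^sup>2 - b\<^sup>2 \<ge> 0)"
proof -
  have a: "\<bar>a\<bar> < 1" and b: "\<bar>b\<bar> < 1"
    using assms(1,2) by auto
  \<comment> \<open>The two factors contribute \<open>2 * t\<close> and division by
    \<open>\<zeta>\<close> removes one \<open>t\<close>. As the angles are periodic,
    \<open>\<phi>\<close> gains exactly \<open>2 * pi\<close> per turn.\<close>
  define \<phi> where "\<phi> t = Arg \<sigma> + t + blaschke_angle a t + blaschke_angle b t" for t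
  have cont: "continuous_on UNIV \<phi>"
    unfolding \<phi>_def using has_real_derivative_lift[OF a b] DERIV_isCont
    by (intro continuous_at_imp_continuous_on) blast
  have \<sigma>: "\<sigma> = cis (Arg \<sigma>)"
    using assms(3) rcis_cmod_Arg[of \<sigma>] by (simp add: rcis_def)
  have lift: "B (cis t) / cis t = cis (\<phi> t)" for t
  proof -
    have "B (cis t) / cis t =
        cis (Arg \<sigma>) * cis (t + blaschke_angle a t) * cis (t + blaschke_angle b t) / cis t"
      using \<sigma> by (simp add: assms(4) blaschke_factor_cis[OF a] blaschke_factor_cis[OF b])
    also have "\<dots> = cis (\<phi> t)"
      by (simp add: cis_mult cis_divide \<phi>_def algebra_simps)
    finally show ?thesis .
  qed
  have nz: "1 - complex_of_real c * z \<noteq> 0" if "\<bar>c\<bar> < 1" "z \<in> sphere 0 1" for c z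
  proof
    assume "1 - complex_of_real c * z = 0"
    then have "norm (complex_of_real c * z) = 1" by simp
    then show False using that by (simp add: norm_mult)
  qed
  have contB: "continuous_on (sphere 0 1) (\<lambda>\<zeta>. B \<zeta> / \<zeta>)"
    unfolding assms(4) using nz[OF a] nz[OF b] by (intro continuous_intros) auto
  have "circle_homeomorphism (\<lambda>\<zeta>. B \<zeta> / \<zeta>) \<longleftrightarrow> strict_mono \<phi>"
  proof
    assume "circle_homeomorphism (\<lambda>\<zeta>. B \<zeta> / \<zeta>)"
    then show "strict_mono \<phi>"
      using strict_mono_lift_if_sense_preserving[OF _ cont, of "\<lambda>\<zeta>. B \<zeta> / \<zeta>"] lift
      by (simp add: circle_homeomorphism_def)
  next
    assume "strict_mono \<phi>"
    then show "circle_homeomorphism (\<lambda>\<zeta>. B \<zeta> / \<zeta>)"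
      by (rule circle_homeomorphism_if_lift[OF contB cont _ _ lift]) (simp add: \<phi>_def)
  qed
  also have "\<dots> \<longleftrightarrow> (\<forall>x\<in>{-1..1}. lift_quadratic a b x \<ge> 0)"
    unfolding \<phi>_def using strict_mono_lift_iff[OF a b] .
  finally show ?thesis
    unfolding lift_quadratic_nonneg_iff[OF a b] .
qed

end
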